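(* Let $C=C_{\{\mathcal{I}_n,\mathcal{J}_n\}}\subset\mathbb{R}$ be a nice Cantor set which is $(\alpha_n)$-thick for some sequence $(\alpha_n)_{n\ge1}$, $0<\alpha_n<1$, such that $\sum_n\alpha_n^p<\infty$ for some $0<p<\infty$. Then there is a doubling measure $\mu$ on $\mathbb{R}$ with $\mu(C)>0$.
   Context: A measure means a Borel regular outer measure; $\mu$ on $\mathbb{R}$ is doubling if there is $c<\infty$ with $0<\mu(B(x,2r))\le c\,\mu(B(x,r))<\infty$ for all $x$, $r>0$. A Cantor construction $\{\mathcal{I}_n,\mathcal{J}_n\}_n$: for each $n\in\mathbb{N}$, $\mathcal{I}_n=\{I_{n,i}\}_i$ is a collection of closed intervals with mutually disjoint interiors and $\mathcal{J}_n=\{J_{n,i}\}_i$ a collection of open intervals with $J_{n,i}\subset I_{n,i}$, such that each $I_{n+1,i}$ is contained in some $I_{n,j}$, $\bigcup\mathcal{I}_{n+1}=\bigcup\mathcal{I}_n\setminus\bigcup\mathcal{J}_n$, $\sup_j|I_{n,j}|\to0$, and $\bigcup\mathcal{I}_1$ is bounded; $C=\bigcap_n\bigcup_iI_{n,i}$. Nice: there is $0<c<1$ with $cI_{n,i}\cap J_{n,i}\neq\emptyset$ for all $n,i$ ($cI$ the interval concentric with $I$ of length $c|I|$). $(\alpha_n)$-thick: $|J_{n,i}|\le\alpha_n|I_{n,i}|$ for all $n,i$. *)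

theory Defs
  imports "HOL-Analysis.Analysis"
begin

text \<open>A Cantor construction indexed by generations n \<ge> 1.  For generation n the
  collection I_n is given by an index set Ix n, and for i in Ix n the closed interval
  I_{n,i} = {a n i .. b n i} (with a n i \<le> b n i) and the open interval
  J_{n,i} = {c n i <..< d n i} (with c n i \<le> d n i).\<close>

definition cantor_construction ::
  "(nat \<Rightarrow> 'i set) \<Rightarrow> (nat \<Rightarrow> 'i \<Rightarrow> real) \<Rightarrow> (nat \<Rightarrow> 'i \<Rightarrow> real)
   \<Rightarrow> (nat \<Rightarrow> 'i \<Rightarrow> real) \<Rightarrow> (nat \<Rightarrow> 'i \<Rightarrow> real) \<Rightarrow> bool" where
  "cantor_construction Ix a b c d \<longleftrightarrow>
     (\<forall>n\<ge>1. \<forall>i\<in>Ix n. a n i \<le> b n i \<and> c n i \<le> d n i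
         \<and> {c n i<..<d n i} \<subseteq> {a n i..b n i}) \<and>
     (\<forall>n\<ge>1. \<forall>i\<in>Ix n. \<forall>j\<in>Ix n. i \<noteq> j \<longrightarrow>
         {a n i<..<b n i} \<inter> {a n j<..<b n j} = {}) \<and>
     (\<forall>n\<ge>1. \<forall>i\<in>Ix (Suc n). \<exists>j\<in>Ix n. {a (Suc n) i..b (Suc n) i} \<subseteq> {a n j..b n j}) \<and>
     (\<forall>n\<ge>1. (\<Union>i\<in>Ix (Suc n). {a (Suc n) i..b (Suc n) i}) =
         (\<Union>i\<in>Ix n. {a n i..b n i}) - (\<Union>i\<in>Ix n. {c n i<..<d n i})) \<and>
     (\<forall>\<epsilon>>0. \<exists>N. \<forall>n\<ge>N. \<forall>j\<in>Ix n. b n j - a n j \<le> \<epsilon>) \<and>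
     bounded (\<Union>i\<in>Ix 1. {a 1 i..b 1 i})"

definition cantor_set ::
  "(nat \<Rightarrow> 'i set) \<Rightarrow> (nat \<Rightarrow> 'i \<Rightarrow> real) \<Rightarrow> (nat \<Rightarrow> 'i \<Rightarrow> real) \<Rightarrow> real set" where
  "cantor_set Ix a b = (\<Inter>n\<in>{1..}. \<Union>i\<in>Ix n. {a n i..b n i})"

definition conc_interval :: "real \<Rightarrow> real \<Rightarrow> real \<Rightarrow> real set" where
  "conc_interval t x y = {(x+y)/2 - t*(y-x)/2 .. (x+y)/2 + t*(y-x)/2}"

definition nice_construction ::
  "(nat \<Rightarrow> 'i set) \<Rightarrow> (nat \<Rightarrow> 'i \<Rightarrow> real) \<Rightarrow> (nat \<Rightarrow> 'i \<Rightarrow> real)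
   \<Rightarrow> (nat \<Rightarrow> 'i \<Rightarrow> real) \<Rightarrow> (nat \<Rightarrow> 'i \<Rightarrow> real) \<Rightarrow> bool" where
  "nice_construction Ix a b c d \<longleftrightarrow>
     (\<exists>t. 0 < t \<and> t < 1 \<and> (\<forall>n\<ge>1. \<forall>i\<in>Ix n.
        conc_interval t (a n i) (b n i) \<inter> {c n i<..<d n i} \<noteq> {}))"

definition thick_construction ::
  "(nat \<Rightarrow> real) \<Rightarrow> (nat \<Rightarrow> 'i set) \<Rightarrow> (nat \<Rightarrow> 'i \<Rightarrow> real) \<Rightarrow> (nat \<Rightarrow> 'i \<Rightarrow> real)
   \<Rightarrow> (nat \<Rightarrow> 'i \<Rightarrow> real) \<Rightarrow> (nat \<Rightarrow> 'i \<Rightarrow> real) \<Rightarrow> bool" where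
  "thick_construction \<alpha> Ix a b c d \<longleftrightarrow>
     (\<forall>n\<ge>1. \<forall>i\<in>Ix n. d n i - c n i \<le> \<alpha> n * (b n i - a n i))"

definition doubling_measure :: "real measure \<Rightarrow> bool" where
  "doubling_measure M \<longleftrightarrow> sets M = sets borel \<and>
     (\<exists>C::real. \<forall>x r. r > 0 \<longrightarrow>
        0 < emeasure M (ball x (2*r)) \<and>
        emeasure M (ball x (2*r)) \<le> ennreal C * emeasure M (ball x r) \<and>
        emeasure M (ball x r) < \<infinity>)"

end

theory Submission
  imports Defs
begin

text \<open>The measure is a multiplicative cascade on the 4-adic grid: every cell distributes its mass to
  its four children, with shares bounded below. If two neighbouring cells with different parents
  always receive the same share, then neighbouring masses of the same level are comparable, and the
  measure is doubling.

  Niceness gives in every gap \<open>J\<close> a point \<open>z\<close> at distance at least \<open>\<eta> |I|\<close> from the boundary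
  of its interval \<open>I\<close>. At all levels \<open>k\<close> with \<open>|J| \<le> 4 ^ -k \<le> \<eta> |I| / 2\<close> the cell containing \<open>z\<close>
  gets only the share \<open>4 ^ -q\<close>, so \<open>J\<close> has mass at most a constant times
  \<open>(|J| / |I|) ^ q\<close> times the mass of \<open>I\<close>. These prescriptions do not interfere: a gap is
  disjoint from all later intervals, so the points \<open>z\<close>, \<open>z'\<close> of two gaps are at distance at least
  \<open>\<eta> min |I| |I'|\<close>, and a cell meets at most one active gap. With \<open>q \<ge> p\<close> the total mass
  of the gaps inside an interval of a late generation is smaller than the mass of that interval.\<close>

section \<open>Doubling cascades\<close>

text \<open>The cell \<open>j\<close> of level \<open>k\<close> is the interval from \<open>j / 4 ^ k\<close> to \<open>(j + 1) / 4 ^ k\<close>; its parent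
  is the cell \<open>j div 4\<close> of level \<open>k - 1\<close>, and \<open>s k\<close> prescribes the shares of cells of level \<open>k + 1\<close>.\<close>
fun cell_mass :: "(nat \<Rightarrow> int \<Rightarrow> real) \<Rightarrow> nat \<Rightarrow> int \<Rightarrow> real" where
  "cell_mass s 0 j = 1"
| "cell_mass s (Suc k) j = cell_mass s k (j div 4) * s k j"

text \<open>The distribution function of the future measure at \<open>j / 4 ^ k\<close>, normalised
  to be \<open>j\<close> at the integers. The sum runs over the siblings to the left of cell
  \<open>j\<close>, so it is empty for a first child.\<close>

fun grid_value :: "(nat \<Rightarrow> int \<Rightarrow> real) \<Rightarrow> nat \<Rightarrow> int \<Rightarrow> real" where
  "grid_value s 0 j = real_of_int j"
| "grid_value s (Suc k) j =
     grid_value s k (j div 4) + (\<Sum>i\<in>{4 * (j div 4)..<j}. cell_mass s (Suc k) i)"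

lemma floor_power4_Suc: "\<lfloor>4 ^ Suc k * x\<rfloor> div 4 = \<lfloor>4 ^ k * (x::real)\<rfloor>"
  using floor_divide_real_eq_div[of 4 "4 ^ Suc k * x"] by simp

lemma int_quarter_cases:
  obtains g :: int where "j = 4 * g" | g where "j = 4 * g + 1" | g where "j = 4 * g + 2"
    | g where "j = 4 * g + 3"
proof -
  have "j = 4 * (j div 4) + j mod 4" by simp
  moreover have "j mod 4 = 0 \<or> j mod 4 = 1 \<or> j mod 4 = 2 \<or> j mod 4 = 3" by presburger
  ultimately show ?thesis using that by (metis add.right_neutral)
qed

lemma power4_scale:
  fixes x :: real
  assumes "0 < x" "x \<le> 1"
  obtains k where "x \<le> 1 / 4 ^ k" "1 / 4 ^ k < 4 * x"
proof -
  obtain m where m: "(1/4::real) ^ m < x"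
    using real_arch_pow_inv[of x "1/4"] assms by auto
  define n where "n = (LEAST n. (1/4::real) ^ n < x)"
  have n: "(1/4::real) ^ n < x"
    unfolding n_def by (rule LeastI) (rule m)
  have "n \<noteq> 0" using n assms by (cases n) auto
  then obtain k where k: "n = Suc k" by (cases n) auto
  have "\<not> (1/4::real) ^ k < x"
    using not_less_Least[of k "\<lambda>n. (1/4::real) ^ n < x"] k n_def by simp
  with n k show ?thesis
    by (intro that[of k]) (auto simp: power_divide)
qed

text \<open>\<open>share_upper\<close> makes cell masses shrink geometrically, which excludes atoms.
  In \<open>share_matching\<close> the cells \<open>4*g - 1\<close> and \<open>4*g\<close> are the
  last child of one parent and the first child of the next.\<close>

locale quaternary_cascade =
  fixes s :: "nat \<Rightarrow> int \<Rightarrow> real" and \<epsilon> :: real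
  assumes eps_pos: "0 < \<epsilon>"
    and share_lower: "\<And>k j. \<epsilon> \<le> s k j"
    and share_upper: "\<And>k j. s k j \<le> 1/2"
    and share_sum: "\<And>k g. s k (4*g) + s k (4*g+1) + s k (4*g+2) + s k (4*g+3) = 1"
    and share_matching: "\<And>k g. s k (4*g - 1) = s k (4*g)"
begin

section \<open>Comparability of masses on one level\<close>

abbreviation "m \<equiv> cell_mass s"

text \<open>A bound for the quotient of any two shares: the upper bound 1/2 over the lower bound
  \<open>\<epsilon>\<close>.\<close>

definition ratio :: real where "ratio = 1 / (2 * \<epsilon>)"

lemma share_pos: "0 < s k j"
  using share_lower[of k j] eps_pos by linarith

lemma mass_pos: "0 < m k j"
  by (induction k arbitrary: j) (auto intro: mult_pos_pos share_pos)

lemma mass_le: "m k j \<le> (1/2) ^ k"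
proof (induction k arbitrary: j)
  case (Suc k)
  show ?case
    using mult_mono[OF Suc share_upper[of k j]] share_pos[of k j] by (simp add: less_imp_le)
qed simp

lemma ratio_ge_1: "1 \<le> ratio"
  using eps_pos share_lower[of 0 0] share_upper[of 0 0] by (simp add: ratio_def field_simps)

lemma share_ratio: "s k i \<le> ratio * s k j"
proof -
  have "ratio * \<epsilon> \<le> ratio * s k j"
    using share_lower[of k j] ratio_ge_1 by (intro mult_left_mono) auto
  moreover have "ratio * \<epsilon> = 1/2" using eps_pos by (simp add: ratio_def)
  ultimately show ?thesis using share_upper[of k i] by linarith
qed

text \<open>Neighbours with different parents receive equal shares, so the ratio of two neighbouring
  masses is the one created where their ancestors first became siblings.\<close>
lemma mass_neighbours: "m k (j+1) \<le> ratio * m k j \<and> m k j \<le> ratio * m k (j+1)"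
proof (induction k arbitrary: j)
  case 0
  then show ?case using ratio_ge_1 by simp
next
  case (Suc k)
  show ?case
  proof (cases "(j + 1) div 4 = j div 4")
    case True
    have "m k g * s k i \<le> ratio * (m k g * s k l)" for g i l
      using mult_left_mono[OF share_ratio[of k i l], of "m k g"] mass_pos[of k g]
      by (simp add: mult_ac)
    then show ?thesis using True by (simp only: cell_mass.simps)
  next
    case False
    define g where "g = (j + 1) div 4"
    have g: "j = 4 * g - 1" "(j + 1) div 4 = g" "g = j div 4 + 1"
      using False unfolding g_def by presburger+
    have s: "s k (j + 1) = s k j"
      using share_matching[of k g] g(1) by simp
    have "a * s k j \<le> ratio * (b * s k j)" if "a \<le> ratio * b" for a b
      using mult_right_mono[OF that, of "s k j"] share_pos[of k j] by (simp add: mult.assoc)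
    then show ?thesis
      using Suc[of "j div 4"] unfolding cell_mass.simps s g(2) g(3) by blast
  qed
qed

lemma mass_shift: "m k (j + int n) \<le> ratio ^ n * m k j \<and> m k (j - int n) \<le> ratio ^ n * m k j"
proof (induction n)
  case (Suc n)
  have "m k (j + int (Suc n)) \<le> ratio * m k (j + int n)"
    using mass_neighbours[of k "j + int n"] by (simp add: algebra_simps)
  moreover have "m k (j - int (Suc n)) \<le> ratio * m k (j - int n)"
    using mass_neighbours[of k "j - int (Suc n)"] by (simp add: algebra_simps)
  moreover have "ratio * m k (j + int n) \<le> ratio * (ratio ^ n * m k j)"
    "ratio * m k (j - int n) \<le> ratio * (ratio ^ n * m k j)"
    using Suc ratio_ge_1 by (auto intro!: mult_left_mono)
  ultimately show ?case by (simp add: mult.assoc)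
qed simp

text \<open>Among siblings the sum gains one term. At a last child the four shares add up to 1, so
  the claim reduces to the step of the parent.\<close>

lemma grid_step: "grid_value s k (j + 1) = grid_value s k j + m k j"
proof (induction k arbitrary: j)
  case (Suc k)
  show ?case
  proof (cases "(j + 1) div 4 = j div 4")
    case True
    have "{4 * (j div 4)..<j+1} = insert j {4 * (j div 4)..<j}"
      by auto
    then show ?thesis using True by simp
  next
    case False
    define g where "g = j div 4"
    have g: "j = 4 * g + 3" "(j + 1) div 4 = g + 1"
      using False unfolding g_def by presburger+
    have "{4 * g..<4 * g + 3} = {4*g, 4*g+1, 4*g+2}" by auto
    then have "grid_value s (Suc k) j + m (Suc k) j
        = grid_value s k g + m k g * (s k (4*g) + s k (4*g+1) + s k (4*g+2) + s k (4*g+3))"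
      using g by (simp add: algebra_simps)
    also have "\<dots> = grid_value s k (g + 1)"
      using Suc[of g] share_sum by simp
    also have "\<dots> = grid_value s (Suc k) (j + 1)"
      using g by (simp add: add.commute)
    finally show ?thesis by simp
  qed
qed simp

lemma grid_mono: "i \<le> j \<Longrightarrow> grid_value s k i \<le> grid_value s k j"
proof (induction j rule: int_ge_induct)
  case (step j)
  then show ?case using grid_step[of k j] mass_pos[of k j] by simp
qed simp

lemma grid_refine: "grid_value s (k + n) (j * 4 ^ n) = grid_value s k j"
proof (induction n)
  case (Suc n)
  have "j * 4 ^ Suc n = 4 * (j * 4 ^ n)" by simp
  then have "grid_value s (k + Suc n) (j * 4 ^ Suc n) = grid_value s (k + n) (j * 4 ^ n)"
    by (simp only: add_Suc_right grid_value.simps) simp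
  with Suc show ?case by simp
qed simp

section \<open>The distribution function as a limit along the grids\<close>

definition approx_cdf :: "real \<Rightarrow> nat \<Rightarrow> real" where
  "approx_cdf x k = grid_value s k \<lfloor>4 ^ k * x\<rfloor>"

definition cdf :: "real \<Rightarrow> real" where "cdf x = lim (approx_cdf x)"

lemma approx_cdf_tendsto: "approx_cdf x \<longlonglongrightarrow> cdf x"
proof -
  have inc: "approx_cdf x k \<le> approx_cdf x (Suc k)" for k
  proof -
    have "0 \<le> m k i * s k j" for i j
      using mass_pos[of k i] share_pos[of k j] by simp
    then show ?thesis
      using floor_power4_Suc[of k x] by (simp add: approx_cdf_def sum_nonneg)
  qed
  \<comment> \<open>The right ends of the nested cells containing \<open>x\<close> never move to the
    right, so the increasing approximations stay below the value at the right end of the unit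
    cell.\<close>
  have upper: "grid_value s k (\<lfloor>4 ^ k * x\<rfloor> + 1) \<le> grid_value s 0 (\<lfloor>x\<rfloor> + 1)" for k
  proof (induction k)
    case (Suc k)
    define g where "g = \<lfloor>4 ^ k * x\<rfloor>"
    have "i + 1 \<le> (i div 4 + 1) * 4" for i :: int
      by presburger
    from this[of "\<lfloor>4 ^ Suc k * x\<rfloor>"] have "\<lfloor>4 ^ Suc k * x\<rfloor> + 1 \<le> (g + 1) * 4"
      unfolding floor_power4_Suc g_def .
    from grid_mono[OF this, of "Suc k"] have "grid_value s (Suc k) (\<lfloor>4 ^ Suc k * x\<rfloor> + 1) \<le> grid_value s k (g + 1)"
      unfolding Suc_eq_plus1 grid_refine[of k 1 "g + 1", unfolded power_one_right] .
    with Suc show ?case unfolding g_def by (rule order_trans[rotated])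
  qed simp
  have bd: "approx_cdf x k \<le> grid_value s 0 (\<lfloor>x\<rfloor> + 1)" for k
    using upper[of k] grid_step[of k "\<lfloor>4 ^ k * x\<rfloor>"] mass_pos[of k "\<lfloor>4 ^ k * x\<rfloor>"]
    by (simp add: approx_cdf_def)
  have "incseq (approx_cdf x)"
    by (rule incseq_SucI) (rule inc)
  then have "convergent (approx_cdf x)"
    using bd by (blast elim: incseq_convergent intro: convergentI)
  then show ?thesis
    by (simp add: cdf_def convergent_LIMSEQ_iff)
qed

lemma cdf_mono: "x \<le> y \<Longrightarrow> cdf x \<le> cdf y"
proof (rule LIMSEQ_le[OF approx_cdf_tendsto approx_cdf_tendsto], intro exI allI impI)
  fix n
  assume "x \<le> y"
  then show "approx_cdf x n \<le> approx_cdf y n"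
    unfolding approx_cdf_def by (intro grid_mono floor_mono mult_left_mono) auto
qed

lemma cdf_grid: "cdf (of_int j / 4 ^ k) = grid_value s k j"
proof (rule LIMSEQ_unique[OF approx_cdf_tendsto])
  \<comment> \<open>From level \<open>k\<close> on the point is a grid point, and refinement does
    not change its value.\<close>
  have "approx_cdf (of_int j / 4 ^ k) (n + k) = grid_value s k j" for n
  proof -
    have "4 ^ (n + k) * (of_int j / 4 ^ k :: real) = of_int (j * 4 ^ n)"
      by (simp add: power_add)
    then have "approx_cdf (of_int j / 4 ^ k) (n + k) = grid_value s (n + k) (j * 4 ^ n)"
      unfolding approx_cdf_def by (metis floor_of_int)
    then show ?thesis using grid_refine[of k n j] by (simp add: add.commute)
  qed
  then show "approx_cdf (of_int j / 4 ^ k) \<longlonglongrightarrow> grid_value s k j"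
    by - (rule LIMSEQ_offset[where k = k], simp)
qed

text \<open>The block consists of the \<open>2 * n\<close> cells from \<open>j - n\<close> to
  \<open>j + n - 1\<close>, all within \<open>n\<close> steps of \<open>j\<close>, so
  \<open>mass_shift\<close> bounds each of them.\<close>

lemma cdf_block:
  "cdf (of_int (j + int n) / 4 ^ k) - cdf (of_int (j - int n) / 4 ^ k) \<le> 2 * real n * ratio ^ n * m k j"
proof (induction n)
  case (Suc n)
  have r: "ratio ^ n \<le> ratio ^ Suc n"
    using ratio_ge_1 by (intro power_increasing) auto
  have up: "m k (j + int n) \<le> ratio ^ Suc n * m k j"
    using mass_shift[of k j n] mult_right_mono[OF r, of "m k j"] mass_pos[of k j] by linarith
  have low: "m k (j - int (Suc n)) \<le> ratio ^ Suc n * m k j"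
    using mass_shift[of k j "Suc n"] by simp
  have "2 * real n * ratio ^ n * m k j \<le> 2 * real n * ratio ^ Suc n * m k j"
    using r mass_pos[of k j] by (intro mult_right_mono mult_left_mono) auto
  moreover have "grid_value s k (j + int (Suc n)) = grid_value s k (j + int n) + m k (j + int n)"
    using grid_step[of k "j + int n"] by (simp add: algebra_simps)
  moreover have "grid_value s k (j - int n) = grid_value s k (j - int (Suc n)) + m k (j - int (Suc n))"
    using grid_step[of k "j - int (Suc n)"] by (simp add: algebra_simps)
  ultimately have "cdf (of_int (j + int (Suc n)) / 4 ^ k) - cdf (of_int (j - int (Suc n)) / 4 ^ k)
      \<le> 2 * real n * ratio ^ Suc n * m k j + 2 * (ratio ^ Suc n * m k j)"
    using Suc up low unfolding cdf_grid by linarith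
  also have "\<dots> = 2 * real (Suc n) * ratio ^ Suc n * m k j"
    by (simp add: algebra_simps)
  finally show ?case .
qed simp

lemma floor_cell:
  fixes x :: real
  shows "of_int \<lfloor>4 ^ k * x\<rfloor> / 4 ^ k \<le> x" "x < of_int (\<lfloor>4 ^ k * x\<rfloor> + 1) / 4 ^ k"
proof -
  have "of_int \<lfloor>4 ^ k * x\<rfloor> \<le> 4 ^ k * x" "4 ^ k * x < of_int (\<lfloor>4 ^ k * x\<rfloor> + 1)"
    by linarith+
  then show "of_int \<lfloor>4 ^ k * x\<rfloor> / 4 ^ k \<le> x" "x < of_int (\<lfloor>4 ^ k * x\<rfloor> + 1) / 4 ^ k"
    by (simp_all add: pos_divide_le_eq pos_less_divide_eq mult.commute del: of_int_add)
qed

lemma cdf_cell: "cdf (of_int (j + 1) / 4 ^ k) - cdf (of_int j / 4 ^ k) = m k j"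
  unfolding cdf_grid grid_step by simp

text \<open>The interval is covered by two neighbouring cells of level \<open>k\<close>, each of
  mass at most \<open>(1/2) ^ k\<close>. This gives continuity of \<open>cdf\<close>.\<close>

lemma cdf_small:
  assumes "x \<le> y" "y \<le> x + 1 / 4 ^ k"
  shows "cdf y - cdf x \<le> 2 * (1/2) ^ k"
proof -
  define j where "j = \<lfloor>4 ^ k * x\<rfloor>"
  have "of_int j / 4 ^ k \<le> x" "y \<le> of_int (j + 1 + 1) / 4 ^ k"
    using floor_cell[where k = k and x = x] assms unfolding j_def by (auto simp: add_divide_distrib)
  then have "cdf y - cdf x \<le> m k j + m k (j + 1)"
    using cdf_mono[of "of_int j / 4 ^ k" x] cdf_mono[of y "of_int (j + 1 + 1) / 4 ^ k"]
      cdf_cell[of j k] cdf_cell[of "j + 1" k] by linarith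
  then show ?thesis using mass_le[of k j] mass_le[of k "j + 1"] by linarith
qed

lemma isCont_cdf: "isCont cdf x"
  unfolding continuous_at_eps_delta
proof (intro allI impI)
  fix e :: real
  assume "0 < e"
  then obtain k where k: "(1/2::real) ^ k < e / 2"
    using real_arch_pow_inv[of "e/2" "1/2"] by auto
  have "\<bar>cdf y - cdf x\<bar> < e" if "\<bar>y - x\<bar> < 1 / 4 ^ k" for y
  proof (cases "x \<le> y")
    case True
    then show ?thesis using cdf_small[of x y k] cdf_mono[of x y] that k by linarith
  next
    case False
    then show ?thesis using cdf_small[of y x k] cdf_mono[of y x] that k by linarith
  qed
  then show "\<exists>d>0. \<forall>y. dist y x < d \<longrightarrow> dist (cdf y) (cdf x) < e"
    by (intro exI[of _ "1 / 4 ^ k"]) (auto simp: dist_real_def)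
qed

section \<open>The Stieltjes measure and its doubling property\<close>

definition cascade_measure :: "real measure" where
  "cascade_measure = interval_measure cdf"

lemma sets_cascade_measure [measurable_cong, simp]: "sets cascade_measure = sets borel"
  by (simp add: cascade_measure_def)

lemma emeasure_cascade_Icc: "x \<le> y \<Longrightarrow> emeasure cascade_measure {x..y} = ennreal (cdf y - cdf x)"
proof -
  assume "x \<le> y"
  moreover have "continuous_on UNIV cdf"
    by (intro continuous_at_imp_continuous_on ballI isCont_cdf)
  ultimately show ?thesis
    unfolding cascade_measure_def using cdf_mono by (intro emeasure_interval_measure_Icc)
qed

lemma emeasure_cascade_cell: "emeasure cascade_measure {of_int j / 4 ^ k..of_int (j + 1) / 4 ^ k} = ennreal (m k j)"
proof -
  have "of_int j / 4 ^ k \<le> (of_int (j + 1) / 4 ^ k :: real)"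
    by (rule divide_right_mono) auto
  from emeasure_cascade_Icc[OF this] show ?thesis
    by (simp only: cdf_cell)
qed

lemma emeasure_cascade_le:
  assumes "A \<subseteq> {of_int (j - int n) / 4 ^ k..of_int (j + int n) / 4 ^ k}"
  shows "emeasure cascade_measure A \<le> ennreal (2 * real n * ratio ^ n * m k j)"
proof -
  let ?l = "of_int (j - int n) / 4 ^ k :: real" and ?u = "of_int (j + int n) / 4 ^ k :: real"
  have "?l \<le> ?u" by (rule divide_right_mono) auto
  have "emeasure cascade_measure A \<le> emeasure cascade_measure {?l..?u}"
    using assms by (intro emeasure_mono) auto
  also have "\<dots> = ennreal (cdf ?u - cdf ?l)"
    by (rule emeasure_cascade_Icc) fact
  also have "\<dots> \<le> ennreal (2 * real n * ratio ^ n * m k j)"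
    using cdf_block by (intro ennreal_leI)
  finally show ?thesis .
qed

text \<open>Unit cells have mass 1, so \<open>cdf\<close> is the identity at integers. This handles
  balls larger than the coarsest cells.\<close>

lemma cdf_near_id: "\<bar>cdf x - x\<bar> \<le> 1"
proof -
  have c: "cdf (of_int j) = of_int j" for j
    using cdf_grid[of j 0] by simp
  have "of_int \<lfloor>x\<rfloor> \<le> cdf x"
    using cdf_mono[of "of_int \<lfloor>x\<rfloor>" x] c by simp
  moreover have "cdf x \<le> of_int (\<lfloor>x\<rfloor> + 1)"
    using cdf_mono[of x "of_int (\<lfloor>x\<rfloor> + 1)"] unfolding c by simp
  ultimately show ?thesis by linarith
qed

lemma ball_estimates:
  assumes "0 < r"
  shows "0 < emeasure cascade_measure (ball x r)"
    and "emeasure cascade_measure (ball x (2 * r))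
      \<le> ennreal (max 10 (34 * ratio ^ 17)) * emeasure cascade_measure (ball x r)"
proof -
  \<comment> \<open>The number \<open>v\<close> is the mass of one cell for small radii and
    \<open>r / 4\<close> for large ones; it yields both positivity and the doubling bound.\<close>
  have "\<exists>v>0. ennreal v \<le> emeasure cascade_measure (ball x r) \<and>
     emeasure cascade_measure (ball x (2 * r)) \<le> ennreal (max 10 (34 * ratio ^ 17) * v)"
  proof (cases "r \<le> 2")
    case True
    then obtain k where k: "r / 2 \<le> 1 / 4 ^ k" "1 / 4 ^ k < 4 * (r / 2)"
      using power4_scale[of "r / 2"] assms by auto
    define j where "j = \<lfloor>4 ^ Suc k * x\<rfloor>"
    define h :: real where "h = 1 / 4 ^ Suc k"
    \<comment> \<open>The cell length \<open>h\<close> is less than \<open>r\<close>, so the cell of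
      \<open>x\<close> lies in the small ball. As \<open>2 * r\<close> is at most 16 cells, the
      large ball stays within 17 cells of the left end of that cell.\<close>
    have h: "h < r" "2 * r \<le> 16 * h" using k by (auto simp: h_def)
    have cell: "of_int (j + i) / 4 ^ Suc k = of_int j / 4 ^ Suc k + of_int i * h" for i
      by (simp add: h_def add_divide_distrib)
    have x: "of_int j / 4 ^ Suc k \<le> x" "x < of_int j / 4 ^ Suc k + h"
      using floor_cell[where k = "Suc k" and x = x] unfolding j_def[symmetric] cell by simp_all
    have "{of_int j / 4 ^ Suc k..of_int (j + 1) / 4 ^ Suc k} \<subseteq> ball x r"
      unfolding cell using x h by (auto simp: dist_real_def)
    then have "ennreal (m (Suc k) j) \<le> emeasure cascade_measure (ball x r)"
      unfolding emeasure_cascade_cell[symmetric] by (intro emeasure_mono) auto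
    moreover have "ball x (2 * r) \<subseteq> {of_int (j - int 17) / 4 ^ Suc k..of_int (j + int 17) / 4 ^ Suc k}"
      using cell[of "- int 17"] cell[of "int 17"] x h by (auto simp: dist_real_def)
    then have "emeasure cascade_measure (ball x (2 * r)) \<le> ennreal (2 * real 17 * ratio ^ 17 * m (Suc k) j)"
      by (rule emeasure_cascade_le)
    moreover have "2 * real 17 * ratio ^ 17 * m (Suc k) j \<le> max 10 (34 * ratio ^ 17) * m (Suc k) j"
      using mass_pos[of "Suc k" j] by (intro mult_right_mono) auto
    then have "ennreal (2 * real 17 * ratio ^ 17 * m (Suc k) j) \<le> ennreal (max 10 (34 * ratio ^ 17) * m (Suc k) j)"
      by (rule ennreal_leI)
    ultimately show ?thesis
      using mass_pos[of "Suc k" j] by (blast intro: order_trans)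
  next
    case False
    \<comment> \<open>The inner interval has length \<open>5 * r / 4\<close>; comparison with the
      identity loses at most 2, and \<open>r > 2\<close> leaves \<open>r / 4\<close>. The outer one
      has mass at most \<open>4 * r + 2\<close>.\<close>
    have "{x - r / 2 .. x + r * (3/4)} \<subseteq> ball x r" "ball x (2 * r) \<subseteq> {x - 2 * r..x + 2 * r}"
      using assms by (auto simp: dist_real_def)
    then have le: "emeasure cascade_measure {x - r / 2 .. x + r * (3/4)} \<le> emeasure cascade_measure (ball x r)"
      "emeasure cascade_measure (ball x (2 * r)) \<le> emeasure cascade_measure {x - 2 * r..x + 2 * r}"
      by (auto intro!: emeasure_mono)
    have eq: "emeasure cascade_measure {x - r / 2 .. x + r * (3/4)} = ennreal (cdf (x + r * (3/4)) - cdf (x - r / 2))"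
      "emeasure cascade_measure {x - 2 * r..x + 2 * r} = ennreal (cdf (x + 2 * r) - cdf (x - 2 * r))"
      using assms by (auto intro!: emeasure_cascade_Icc)
    have "ennreal (r / 4) \<le> ennreal (cdf (x + r * (3/4)) - cdf (x - r / 2))"
      by (rule ennreal_leI)
        (use cdf_near_id[of "x + r * (3/4)"] cdf_near_id[of "x - r/2"] False in linarith)
    moreover have "ennreal (cdf (x + 2 * r) - cdf (x - 2 * r)) \<le> ennreal (max 10 (34 * ratio ^ 17) * (r / 4))"
    proof (rule ennreal_leI)
      have "max 10 (34 * ratio ^ 17) * (r / 4) \<ge> 34 * (r / 4)"
        using assms one_le_power[OF ratio_ge_1, of 17] by (intro mult_right_mono) auto
      then show "cdf (x + 2 * r) - cdf (x - 2 * r) \<le> max 10 (34 * ratio ^ 17) * (r / 4)"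
        using cdf_near_id[of "x + 2 * r"] cdf_near_id[of "x - 2 * r"] False by linarith
    qed
    ultimately have "ennreal (r / 4) \<le> emeasure cascade_measure (ball x r)"
      "emeasure cascade_measure (ball x (2 * r)) \<le> ennreal (max 10 (34 * ratio ^ 17) * (r / 4))"
      using le unfolding eq by (blast intro: order_trans)+
    then show ?thesis
      using assms by (intro exI[of _ "r / 4"]) auto
  qed
  then obtain v where v: "v > 0" "ennreal v \<le> emeasure cascade_measure (ball x r)"
    "emeasure cascade_measure (ball x (2 * r)) \<le> ennreal (max 10 (34 * ratio ^ 17) * v)"
    by blast
  show "0 < emeasure cascade_measure (ball x r)"
    using v(1,2) by (meson ennreal_less_zero_iff less_le_trans)
  have "ennreal (max 10 (34 * ratio ^ 17) * v) = ennreal (max 10 (34 * ratio ^ 17)) * ennreal v"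
    using v(1) by (intro ennreal_mult) auto
  also have "\<dots> \<le> ennreal (max 10 (34 * ratio ^ 17)) * emeasure cascade_measure (ball x r)"
    using v(2) by (intro mult_left_mono) auto
  finally show "emeasure cascade_measure (ball x (2 * r))
      \<le> ennreal (max 10 (34 * ratio ^ 17)) * emeasure cascade_measure (ball x r)"
    using v(3) by (rule order_trans[rotated])
qed

lemma doubling_cascade_measure: "doubling_measure cascade_measure"
  unfolding doubling_measure_def
proof (intro conjI exI[of _ "max 10 (34 * ratio ^ 17)"] allI impI)
  fix x r :: real
  assume r: "0 < r"
  have "emeasure cascade_measure (ball x r) \<le> emeasure cascade_measure {x - r..x + r}"
    by (intro emeasure_mono) (auto simp: dist_real_def)
  also have "\<dots> < \<infinity>" using r by (simp add: emeasure_cascade_Icc)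
  finally show "emeasure cascade_measure (ball x r) < \<infinity>" .
qed (auto intro: ball_estimates)

end

section \<open>Cascades that are thin near gaps\<close>

text \<open>The cell \<open>R\<close> is completed by its neighbour across the boundary of their parents, so that
  the shares on both sides of such a boundary agree.\<close>
definition marked_cells :: "int \<Rightarrow> int set" where
  "marked_cells R = (if R mod 4 = 0 then {R - 1, R} else if R mod 4 = 3 then {R, R + 1} else {R})"

lemma marked_cells_self: "R \<in> marked_cells R"
  by (simp add: marked_cells_def)

lemma marked_cells_near: "j \<in> marked_cells R \<Longrightarrow> \<bar>j - R\<bar> \<le> 1"
  by (auto simp: marked_cells_def split: if_splits)

lemma marked_cells_matching: "4 * g - 1 \<in> marked_cells R \<longleftrightarrow> 4 * g \<in> marked_cells R"
  unfolding marked_cells_def by (cases R rule: int_quarter_cases) (auto, presburger+)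

text \<open>The partner of a marked cell always has another parent, so one point marks at most one
  child in each family.\<close>

lemma marked_cells_unique:
  assumes "i \<in> marked_cells R" "j \<in> marked_cells R" "i div 4 = j div 4"
  shows "i = j"
proof -
  have "(R - 1) div 4 \<noteq> R div 4" if "R mod 4 = 0" using that by presburger
  moreover have "(R + 1) div 4 \<noteq> R div 4" if "R mod 4 = 3" using that by presburger
  ultimately show ?thesis
    using assms by (auto simp: marked_cells_def split: if_splits)
qed

text \<open>A triple \<open>(z, L, l)\<close> stands for a gap of length \<open>l\<close> around \<open>z\<close> whose surrounding interval
  has length comparable to \<open>L\<close>.\<close>
definition reduced :: "(real \<times> real \<times> real) set \<Rightarrow> nat \<Rightarrow> int \<Rightarrow> bool" where
  "reduced S k j \<longleftrightarrow> (\<exists>(z, L, l)\<in>S. l \<le> 1 / 4 ^ k \<and> 1 / 4 ^ k \<le> L \<and>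
     j \<in> marked_cells \<lfloor>4 ^ Suc k * z\<rfloor>)"

text \<open>The mass taken from a reduced cell goes to an inner sibling; the outer children 0 and 3 keep
  the share 1/4 unless they are reduced themselves.\<close>
definition gap_share :: "(real \<times> real \<times> real) set \<Rightarrow> real \<Rightarrow> nat \<Rightarrow> int \<Rightarrow> real" where
  "gap_share S \<epsilon> k j =
    (if reduced S k j then \<epsilon>
     else if j mod 4 = 1 \<and> (reduced S k (j - 1) \<or> reduced S k (j + 1) \<or> reduced S k (j + 2))
       \<or> j mod 4 = 2 \<and> reduced S k (j - 1) then 1/2 - \<epsilon>
     else 1/4)"

locale gap_system =
  fixes S :: "(real \<times> real \<times> real) set" and q :: nat
  assumes separated: "\<And>z L l z' L' l'. (z, L, l) \<in> S \<Longrightarrow> (z', L', l') \<in> S \<Longrightarrow>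
      (z, L, l) = (z', L', l') \<or> 2 * min L L' \<le> \<bar>z - z'\<bar>"
    and exponent_pos: "1 \<le> q"
begin

text \<open>Distinct triples active at level \<open>k\<close> have points at distance at least
  \<open>2 / 4 ^ k\<close>, that is 8 cells of level \<open>Suc k\<close>. Marked siblings would
  force the points to be closer, so both come from one triple.\<close>

lemma reduced_unique:
  assumes i: "reduced S k i" and j: "reduced S k j" and "i div 4 = j div 4"
  shows "i = j"
proof -
  obtain z L l where z: "(z, L, l) \<in> S" "1 / 4 ^ k \<le> L" "i \<in> marked_cells \<lfloor>4 ^ Suc k * z\<rfloor>"
    using i unfolding reduced_def by auto
  obtain z' L' l' where z': "(z', L', l') \<in> S" "1 / 4 ^ k \<le> L'" "j \<in> marked_cells \<lfloor>4 ^ Suc k * z'\<rfloor>"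
    using j unfolding reduced_def by auto
  define u where "u = 4 ^ Suc k * z"
  define v where "v = 4 ^ Suc k * z'"
  have "\<bar>i - \<lfloor>u\<rfloor>\<bar> \<le> 1" "\<bar>j - \<lfloor>v\<rfloor>\<bar> \<le> 1"
    using z(3) z'(3) marked_cells_near unfolding u_def v_def by blast+
  moreover have "\<bar>i - j\<bar> \<le> 3" using assms(3) by presburger
  ultimately have "\<bar>\<lfloor>u\<rfloor> - \<lfloor>v\<rfloor>\<bar> \<le> 5" by linarith
  then have "\<bar>u - v\<bar> < 8" by linarith
  moreover have "u - v = 4 ^ Suc k * (z - z')"
    by (simp add: u_def v_def algebra_simps)
  ultimately have "4 ^ Suc k * \<bar>z - z'\<bar> < 8"
    by (simp add: abs_mult)
  then have "\<bar>z - z'\<bar> < 2 * (1 / 4 ^ k)"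
    by (simp add: field_simps)
  then have "(z, L, l) = (z', L', l')"
    using separated[OF z(1) z'(1)] z(2) z'(2) by linarith
  then show ?thesis
    using marked_cells_unique[OF z(3) _ assms(3)] z'(3) by simp
qed

text \<open>A level divides lengths by 4 and the mass near an active gap by \<open>4 ^ q\<close>, so
  this mass scales like the \<open>q\<close>-th power of length.\<close>

definition \<epsilon> :: real where "\<epsilon> = (1/4) ^ q"

lemma eps_bounds: "0 < \<epsilon>" "\<epsilon> \<le> 1/4"
  using power_decreasing[of 1 q "1/4::real"] exponent_pos by (auto simp: \<epsilon>_def)

sublocale quaternary_cascade "gap_share S \<epsilon>" \<epsilon>
proof
  show "0 < \<epsilon>" by (rule eps_bounds)
  show "\<epsilon> \<le> gap_share S \<epsilon> k j" "gap_share S \<epsilon> k j \<le> 1/2" for k j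
    using eps_bounds by (auto simp: gap_share_def)
  fix k :: nat and g :: int
  have mods: "(4 * g) mod 4 = 0" "(4 * g + 1) mod 4 = 1" "(4 * g + 2) mod 4 = 2"
    "(4 * g + 3) mod 4 = 3" "(4 * g - 1) mod 4 = 3"
    by presburger+
  have offsets: "4 * g + 1 - 1 = 4 * g" "4 * g + 1 + 1 = 4 * g + 2" "4 * g + 1 + 2 = 4 * g + 3"
    "4 * g + 2 - 1 = 4 * g + 1"
    by simp_all
  \<comment> \<open>An outer child has share \<open>\<epsilon>\<close> or 1/4 according only to
    whether it is reduced itself, and completion by partners makes this agree across the
    boundary.\<close>
  have "reduced S k (4 * g - 1) \<longleftrightarrow> reduced S k (4 * g)"
    unfolding reduced_def marked_cells_matching ..
  then show "gap_share S \<epsilon> k (4 * g - 1) = gap_share S \<epsilon> k (4 * g)"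
    by (simp add: gap_share_def mods)
  have "\<not> (reduced S k (4 * g + a) \<and> reduced S k (4 * g + b))"
    if "0 \<le> a" "a < b" "b < 4" for a b :: int
  proof -
    have "(4 * g + a) div 4 = (4 * g + b) div 4" using that by presburger
    then show ?thesis using reduced_unique[of k "4 * g + a" "4 * g + b"] that by auto
  qed
  from this[of 0 1] this[of 0 2] this[of 0 3] this[of 1 2] this[of 1 3] this[of 2 3]
  show "gap_share S \<epsilon> k (4*g) + gap_share S \<epsilon> k (4*g+1) + gap_share S \<epsilon> k (4*g+2)
      + gap_share S \<epsilon> k (4*g+3) = 1"
    unfolding gap_share_def mods offsets add_0_right
    by (cases "reduced S k (4*g)"; cases "reduced S k (4*g+1)"; cases "reduced S k (4*g+2)";
        cases "reduced S k (4*g+3)") simp_all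
qed

text \<open>At each of the \<open>n\<close> levels from \<open>k\<close> on the triple is active, so
  the child containing \<open>z\<close> is reduced and contributes one factor
  \<open>\<epsilon>\<close>.\<close>

lemma mass_decay:
  assumes "(z, L, l) \<in> S" "1 / 4 ^ k \<le> L" "l \<le> 1 / 4 ^ (k + n)"
  shows "m (k + n) \<lfloor>4 ^ (k + n) * z\<rfloor> = \<epsilon> ^ n * m k \<lfloor>4 ^ k * z\<rfloor>"
  using assms(3)
proof (induction n)
  case (Suc n)
  have mono: "1 / 4 ^ (k + Suc n) \<le> (1 / 4 ^ (k + n) :: real)"
    "1 / 4 ^ (k + n) \<le> (1 / 4 ^ k :: real)"
    by (intro divide_left_mono power_increasing; simp)+
  have "l \<le> 1 / 4 ^ (k + n)" "1 / 4 ^ (k + n) \<le> L"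
    using Suc.prems mono assms(2) by linarith+
  then have "reduced S (k + n) \<lfloor>4 ^ Suc (k + n) * z\<rfloor>"
    using assms(1) marked_cells_self unfolding reduced_def by blast
  then have "gap_share S \<epsilon> (k + n) \<lfloor>4 ^ Suc (k + n) * z\<rfloor> = \<epsilon>"
    by (simp add: gap_share_def)
  then have "m (Suc (k + n)) \<lfloor>4 ^ Suc (k + n) * z\<rfloor> = m (k + n) \<lfloor>4 ^ (k + n) * z\<rfloor> * \<epsilon>"
    unfolding cell_mass.simps floor_power4_Suc by simp
  with Suc.IH \<open>l \<le> 1 / 4 ^ (k + n)\<close> show ?case
    by simp
qed simp

text \<open>Level \<open>Suc k\<close> has cells of length between \<open>L / 4\<close> and
  \<open>L\<close>, level \<open>k1\<close> between \<open>l\<close> and \<open>4 * l\<close>. The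
  coarse cell of \<open>z\<close> lies in \<open>B\<close>, four fine cells cover \<open>A\<close>,
  and \<open>mass_decay\<close> relates the two scales.\<close>

lemma gap_mass:
  assumes S: "(z, L, l) \<in> S" and l: "0 < l" "l \<le> 1" and L: "0 < L" "L \<le> 1"
    and A: "A \<subseteq> {z - l..z + l}" "A \<subseteq> B" and B: "{z - L..z + L} \<subseteq> B" "B \<in> sets borel"
  shows "emeasure cascade_measure A
    \<le> ennreal (4 * ratio ^ 2 * (16 * l / L) ^ q) * emeasure cascade_measure B"
proof -
  obtain k1 where k1: "l \<le> 1 / 4 ^ k1" "1 / 4 ^ k1 < 4 * l"
    using power4_scale l by blast
  obtain k where "L \<le> 1 / 4 ^ k" "1 / 4 ^ k < 4 * L"
    using power4_scale L by blast
  then have k0: "L \<le> 4 * (1 / 4 ^ Suc k)" "1 / 4 ^ Suc k < L" by auto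
  have ratio2: "1 \<le> ratio ^ 2" using ratio_ge_1 by (rule one_le_power)
  show ?thesis
  proof (cases "Suc k \<le> k1")
    case True
    define n where "n = k1 - Suc k"
    have n: "k1 = Suc k + n" using True by (simp add: n_def)
    define R0 where "R0 = \<lfloor>4 ^ Suc k * z\<rfloor>"
    define R1 where "R1 = \<lfloor>4 ^ k1 * z\<rfloor>"
    have mass: "m k1 R1 = \<epsilon> ^ n * m (Suc k) R0"
      using mass_decay[OF S, of "Suc k" n] k0 k1 unfolding n R0_def R1_def by simp
    have cell: "of_int (R1 + i) / 4 ^ k1 = of_int R1 / 4 ^ k1 + of_int i * (1 / 4 ^ k1 :: real)" for i
      by (simp add: add_divide_distrib)
    have z: "of_int R1 / 4 ^ k1 \<le> z" "z < of_int R1 / 4 ^ k1 + 1 / 4 ^ k1"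
      using floor_cell[where k = k1 and x = z] unfolding R1_def[symmetric] cell by simp_all
    have cell2: "of_int (R1 - int 2) / 4 ^ k1 = of_int R1 / 4 ^ k1 - 2 * (1 / 4 ^ k1 :: real)"
      by (simp add: diff_divide_distrib)
    have "A \<subseteq> {of_int (R1 - int 2) / 4 ^ k1..of_int (R1 + int 2) / 4 ^ k1}"
    proof
      fix x assume "x \<in> A"
      then have "z - l \<le> x" "x \<le> z + l" using A by auto
      then show "x \<in> {of_int (R1 - int 2) / 4 ^ k1..of_int (R1 + int 2) / 4 ^ k1}"
        unfolding cell[of "int 2"] cell2 using z k1(1) l(1) by simp
    qed
    then have "emeasure cascade_measure A \<le> ennreal (2 * real 2 * ratio ^ 2 * m k1 R1)"
      by (rule emeasure_cascade_le)
    also have "2 * real 2 * ratio ^ 2 * m k1 R1 \<le> 4 * ratio ^ 2 * (16 * l / L) ^ q * m (Suc k) R0"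
    proof -
      have "(1/4) ^ n = (1 / 4 ^ k1) / (1 / 4 ^ Suc k :: real)"
        by (simp add: n power_add power_divide)
      also have "\<dots> \<le> (4 * l) / (L / 4)"
        using k1 k0 L l by - (rule frac_le, auto)
      finally have "((1/4) ^ n) ^ q \<le> (16 * l / L) ^ q"
        by (intro power_mono) auto
      then have "\<epsilon> ^ n \<le> (16 * l / L) ^ q"
        by (simp only: \<epsilon>_def power_mult[symmetric] mult.commute)
      then have "4 * ratio ^ 2 * \<epsilon> ^ n * m (Suc k) R0 \<le> 4 * ratio ^ 2 * (16 * l / L) ^ q * m (Suc k) R0"
        using ratio2 mass_pos[of "Suc k" R0] by (intro mult_right_mono mult_left_mono) (auto simp del: cell_mass.simps)
      then show ?thesis by (simp add: mass mult.assoc del: cell_mass.simps)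
    qed
    finally have "emeasure cascade_measure A \<le> ennreal (4 * ratio ^ 2 * (16 * l / L) ^ q * m (Suc k) R0)"
      by (simp add: ennreal_leI del: cell_mass.simps)
    also have "\<dots> = ennreal (4 * ratio ^ 2 * (16 * l / L) ^ q) * ennreal (m (Suc k) R0)"
      using mass_pos[of "Suc k" R0] ratio2 l L by (intro ennreal_mult) (auto simp del: cell_mass.simps)
    also have "\<dots> \<le> ennreal (4 * ratio ^ 2 * (16 * l / L) ^ q) * emeasure cascade_measure B"
    proof (intro mult_left_mono)
      have "{of_int R0 / 4 ^ Suc k..of_int (R0 + 1) / 4 ^ Suc k} \<subseteq> {z - L..z + L}"
        using floor_cell[where k = "Suc k" and x = z] k0(2) unfolding R0_def[symmetric]
        by (auto simp: add_divide_distrib)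
      then show "ennreal (m (Suc k) R0) \<le> emeasure cascade_measure B"
        unfolding emeasure_cascade_cell[symmetric] using B by (intro emeasure_mono) auto
    qed simp
    finally show ?thesis .
  next
    \<comment> \<open>The scales are not separated: then \<open>L < 16 * l\<close>, the factor is at
      least 1, and monotonicity suffices.\<close>
    case False
    then have "1 / 4 ^ Suc k \<le> (1 / 4 ^ Suc k1 :: real)"
      by (intro divide_left_mono power_increasing) auto
    then have "L < 16 * l" using k0 k1 by simp
    then have "1 \<le> (16 * l / L) ^ q"
      using L by (intro one_le_power) simp
    with ratio2 have "1 * 1 \<le> ratio ^ 2 * (16 * l / L) ^ q"
      by (intro mult_mono) auto
    then have "1 \<le> ennreal (4 * ratio ^ 2 * (16 * l / L) ^ q)"
      by simp
    then have "1 * emeasure cascade_measure B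
        \<le> ennreal (4 * ratio ^ 2 * (16 * l / L) ^ q) * emeasure cascade_measure B"
      by (intro mult_right_mono) auto
    moreover have "emeasure cascade_measure A \<le> emeasure cascade_measure B"
      using A B by (intro emeasure_mono) auto
    ultimately show ?thesis by simp
  qed
qed

end

section \<open>Cantor constructions with centred gaps\<close>

text \<open>Niceness with a chosen witness \<open>z\<close> in each gap and a uniform relative
  margin \<open>\<eta>\<close>. The strict inequalities also make all gaps and intervals
  nondegenerate.\<close>

locale centred_cantor =
  fixes Ix :: "nat \<Rightarrow> 'i set" and a b c d z :: "nat \<Rightarrow> 'i \<Rightarrow> real" and \<eta> :: real
  assumes construction: "cantor_construction Ix a b c d"
    and margin_pos: "0 < \<eta>"
    and centred: "\<And>n i. 1 \<le> n \<Longrightarrow> i \<in> Ix n \<Longrightarrow> c n i < z n i \<and> z n i < d n i \<and>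
      a n i + \<eta> * (b n i - a n i) \<le> z n i \<and> z n i \<le> b n i - \<eta> * (b n i - a n i)"
begin

section \<open>Position of gaps, intervals and centres\<close>

lemma gap_bounds:
  assumes "1 \<le> n" "i \<in> Ix n"
  shows "a n i \<le> c n i" "d n i \<le> b n i" "c n i < d n i" "a n i < b n i"
proof -
  show cd: "c n i < d n i" using centred[OF assms] by linarith
  have "{c n i<..<d n i} \<subseteq> {a n i..b n i}"
    using construction[unfolded cantor_construction_def, THEN conjunct1, rule_format, OF assms]
    by simp
  then show "a n i \<le> c n i" "d n i \<le> b n i"
    using cd by (auto simp: greaterThanLessThan_subseteq_atLeastAtMost_iff)
  then show "a n i < b n i" using cd by linarith
qed

lemma interiors_disjoint:
  "1 \<le> n \<Longrightarrow> i \<in> Ix n \<Longrightarrow> j \<in> Ix n \<Longrightarrow> i \<noteq> j \<Longrightarrow>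
    {a n i<..<b n i} \<inter> {a n j<..<b n j} = {}"
  by (rule construction[unfolded cantor_construction_def, THEN conjunct2, THEN conjunct1, rule_format])

lemma union_Suc:
  "1 \<le> n \<Longrightarrow> (\<Union>i\<in>Ix (Suc n). {a (Suc n) i..b (Suc n) i}) =
     (\<Union>i\<in>Ix n. {a n i..b n i}) - (\<Union>i\<in>Ix n. {c n i<..<d n i})"
  by (rule construction[unfolded cantor_construction_def, THEN conjunct2, THEN conjunct2,
        THEN conjunct2, THEN conjunct1, rule_format])

lemma union_antimono:
  assumes "1 \<le> n" "n \<le> m"
  shows "(\<Union>i\<in>Ix m. {a m i..b m i}) \<subseteq> (\<Union>i\<in>Ix n. {a n i..b n i})"
  using assms(2)
proof (induction m rule: dec_induct)
  case (step m)
  then show ?case using union_Suc[of m] assms(1) by auto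
qed simp

lemma ancestor:
  assumes "1 \<le> n" "n \<le> m" "i \<in> Ix m"
  shows "\<exists>j\<in>Ix n. {a m i..b m i} \<subseteq> {a n j..b n j}"
  using assms(2,3)
proof (induction m arbitrary: i rule: dec_induct)
  case (step m)
  then obtain k where "k \<in> Ix m" "{a (Suc m) i..b (Suc m) i} \<subseteq> {a m k..b m k}"
    using construction[unfolded cantor_construction_def, THEN conjunct2, THEN conjunct2,
        THEN conjunct1, rule_format, of m i] assms(1) by auto
  with step.IH[of k] show ?case by blast
qed blast

lemma gap_avoids_later:
  assumes "1 \<le> n" "n < m" "i \<in> Ix n" "j \<in> Ix m" "x \<in> {c n i<..<d n i}"
  shows "x \<notin> {a m j..b m j}"
proof
  assume "x \<in> {a m j..b m j}"
  then have "x \<in> (\<Union>i\<in>Ix m. {a m i..b m i})"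
    using assms(4) by blast
  then have "x \<in> (\<Union>i\<in>Ix (Suc n). {a (Suc n) i..b (Suc n) i})"
    using union_antimono[of "Suc n" m] assms(2) by fastforce
  then show False
    using union_Suc[OF assms(1)] assms by auto
qed

lemma dist_outside:
  assumes "1 \<le> n" "i \<in> Ix n" "x \<notin> {a n i<..<b n i}"
  shows "\<eta> * (b n i - a n i) \<le> \<bar>z n i - x\<bar>"
  using centred[OF assms(1,2)] assms(3) by auto

lemma centre_interior:
  assumes "1 \<le> n" "i \<in> Ix n"
  shows "z n i \<in> {a n i<..<b n i}"
  using centred[OF assms] gap_bounds[OF assms] by auto

text \<open>In different generations the earlier centre lies in a removed gap, hence outside the
  later interval, whose margin separates the centres. In one generation disjointness of interiors
  does the same.\<close>

lemma centres_separated: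
  assumes "1 \<le> n" "i \<in> Ix n" "1 \<le> m" "j \<in> Ix m" "(n, i) \<noteq> (m, j)"
  shows "\<eta> * min (b n i - a n i) (b m j - a m j) \<le> \<bar>z n i - z m j\<bar>"
proof -
  have later: "\<eta> * (b m j - a m j) \<le> \<bar>z m j - z n i\<bar>"
    if "1 \<le> n" "n < m" "i \<in> Ix n" "j \<in> Ix m" for n m i j
  proof -
    have "z n i \<notin> {a m j..b m j}"
      using gap_avoids_later[OF that] centred[of n i] that by simp
    then show ?thesis using dist_outside[of m j "z n i"] that by auto
  qed
  have "\<eta> * min (b n i - a n i) (b m j - a m j) \<le> \<eta> * (b n i - a n i)"
    "\<eta> * min (b n i - a n i) (b m j - a m j) \<le> \<eta> * (b m j - a m j)"
    using margin_pos by (auto intro!: mult_left_mono)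
  moreover have "\<eta> * (b n i - a n i) \<le> \<bar>z n i - z m j\<bar> \<or> \<eta> * (b m j - a m j) \<le> \<bar>z m j - z n i\<bar>"
  proof (cases n m rule: linorder_cases)
    case equal
    then have "z m j \<notin> {a n i<..<b n i}"
      using interiors_disjoint[of n i j] centre_interior[of n j] assms by auto
    then show ?thesis using dist_outside[of n i "z m j"] assms by blast
  qed (use later[of n m i j] later[of m n j i] assms in auto)
  ultimately show ?thesis by linarith
qed

lemma same_cell:
  assumes "1 \<le> n" "i \<in> Ix n" "k \<in> Ix n" "x \<in> {a n i..b n i}" "x \<in> {a n k<..<b n k}"
  shows "k = i"
proof (rule ccontr)
  assume "k \<noteq> i"
  have "max (a n i) (a n k) < min (b n i) (b n k)"
    using assms(4,5) gap_bounds(4)[OF assms(1,2)] by auto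
  then obtain y where "max (a n i) (a n k) < y" "y < min (b n i) (b n k)"
    using dense by blast
  then have "y \<in> {a n i<..<b n i} \<inter> {a n k<..<b n k}" by simp
  then show False using interiors_disjoint[OF assms(1-3)] \<open>k \<noteq> i\<close> by blast
qed

text \<open>The left end of an interval survives: a gap containing it would put it in the interior
  of an interval of the same generation, which \<open>same_cell\<close> rules out.\<close>

lemma index_nonempty:
  assumes "Ix 1 \<noteq> {}" "1 \<le> n"
  shows "Ix n \<noteq> {}"
  using assms(2)
proof (induction n rule: dec_induct)
  case base
  then show ?case using assms(1) by simp
next
  case (step n)
  then obtain i where i: "i \<in> Ix n" by blast
  have left: "a n i \<in> {a n i..b n i}" using gap_bounds(4)[of n i] step i by simp
  have "a n i \<notin> {c n j<..<d n j}" if j: "j \<in> Ix n" for j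
  proof
    assume "a n i \<in> {c n j<..<d n j}"
    then have "a n i \<in> {a n j<..<b n j}" using gap_bounds[of n j] step j by auto
    with same_cell[OF _ i j left] step have "j = i" by simp
    then show False
      using \<open>a n i \<in> {a n j<..<b n j}\<close> by simp
  qed
  then have "a n i \<in> (\<Union>i\<in>Ix (Suc n). {a (Suc n) i..b (Suc n) i})"
    using union_Suc[of n] step i left by auto
  then show ?case by blast
qed

lemma countable_index:
  assumes "1 \<le> n"
  shows "countable (Ix n)"
proof (rule countable_image_inj_on)
  let ?U = "\<lambda>i. {a n i<..<b n i}"
  have nonempty: "?U i \<noteq> {}" if "i \<in> Ix n" for i
    using gap_bounds(4)[OF assms that] by simp
  show "countable (?U ` Ix n)"
    by (rule countable_disjoint_open_subsets)
      (use interiors_disjoint[OF assms] in \<open>auto simp: pairwise_def disjnt_def\<close>)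
  show "inj_on ?U (Ix n)"
  proof (rule inj_onI)
    fix i j assume "i \<in> Ix n" "j \<in> Ix n" "?U i = ?U j"
    then show "i = j" using interiors_disjoint[OF assms, of i j] nonempty[of j] by auto
  qed
qed

lemma cantor_set_borel: "cantor_set Ix a b \<in> sets borel"
  unfolding cantor_set_def
  by (intro sets.countable_INT'' sets.countable_UN'' countable_index) auto

text \<open>Only gaps inside the interval \<open>i0\<close> can remove \<open>x\<close>: a gap
  containing \<open>x\<close> puts \<open>x\<close> in the interior of its ancestor of generation
  \<open>N\<close>, which must then be \<open>i0\<close>.\<close>

lemma not_gap_imp_cantor_set:
  assumes "1 \<le> N" "i0 \<in> Ix N" and x: "x \<in> {a N i0..b N i0}"
    and avoid: "\<And>n i. N \<le> n \<Longrightarrow> i \<in> Ix n \<Longrightarrow> {a n i..b n i} \<subseteq> {a N i0..b N i0} \<Longrightarrow>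
      x \<notin> {c n i<..<d n i}"
  shows "x \<in> cantor_set Ix a b"
proof -
  have later: "x \<in> (\<Union>i\<in>Ix n. {a n i..b n i})" if "N \<le> n" for n
    using that
  proof (induction n rule: dec_induct)
    case base
    then show ?case using assms by auto
  next
    case (step n)
    have "x \<notin> {c n i<..<d n i}" if i: "i \<in> Ix n" for i
    proof
      assume gap: "x \<in> {c n i<..<d n i}"
      obtain k where k: "k \<in> Ix N" "{a n i..b n i} \<subseteq> {a N k..b N k}"
        using ancestor[OF assms(1) _ i] step by auto
      have n: "1 \<le> n" using step assms(1) by simp
      have "a N k \<le> a n i" "b n i \<le> b N k"
        using k(2) gap_bounds(4)[OF n i] by auto
      then have "x \<in> {a N k<..<b N k}"
        using gap gap_bounds[OF n i] by auto
      then have "k = i0" using same_cell[OF assms(1,2) k(1) x] by simp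
      then show False using avoid[of n i] step i k gap by auto
    qed
    then show ?case using union_Suc[of n] step assms(1) by auto
  qed
  have "x \<in> (\<Union>i\<in>Ix n. {a n i..b n i})" if "1 \<le> n" for n
    using subsetD[OF union_antimono[OF that, of "max n N"] later[of "max n N"]] by simp
  then show ?thesis by (auto simp: cantor_set_def)
qed

text \<open>If the Cantor set were null, the gaps of generations from \<open>N\<close> on would
  carry all the mass of the interval \<open>i0\<close>, but their total mass is a fraction below 1
  of it.\<close>

lemma cantor_set_positive:
  assumes sets: "sets M = sets borel" and N: "1 \<le> N" "i0 \<in> Ix N"
    and bound: "\<And>n i. N \<le> n \<Longrightarrow> i \<in> Ix n \<Longrightarrow>
      emeasure M {c n i<..<d n i} \<le> ennreal (\<beta> n) * emeasure M {a n i<..<b n i}"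
    and \<beta>: "\<And>n. N \<le> n \<Longrightarrow> 0 \<le> \<beta> n" "summable (\<lambda>n. \<beta> (n + N))" "(\<Sum>n. \<beta> (n + N)) < 1"
    and mass: "0 < emeasure M {a N i0..b N i0}" "emeasure M {a N i0..b N i0} < \<infinity>"
  shows "0 < emeasure M (cantor_set Ix a b)"
proof (rule ccontr)
  assume "\<not> 0 < emeasure M (cantor_set Ix a b)"
  then have null: "emeasure M (cantor_set Ix a b) = 0" by simp
  let ?E = "{a N i0..b N i0}"
  define X where "X n = {i \<in> Ix n. {a n i..b n i} \<subseteq> ?E}" for n
  define G where "G n = (\<Union>i\<in>X n. {c n i<..<d n i})" for n
  have G_sets: "G (n + N) \<in> sets borel" for n
    unfolding G_def X_def using N(1)
    by (intro sets.countable_UN'' countable_subset[OF _ countable_index[of "n + N"]]) auto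
  have union_sets: "(\<Union>n. G (n + N)) \<in> sets borel"
    using G_sets by (intro sets.countable_UN) auto
  have G: "emeasure M (G n) \<le> ennreal (\<beta> n) * emeasure M ?E" if n: "N \<le> n" for n
  proof -
    have n1: "1 \<le> n" using n N by simp
    have count: "countable (X n)"
      unfolding X_def by (rule countable_subset[OF _ countable_index[OF n1]]) auto
    have disj: "disjoint_family_on (\<lambda>i. {a n i<..<b n i}) (X n)"
      using interiors_disjoint[OF n1] unfolding disjoint_family_on_def X_def by blast
    have sub: "{c n i<..<d n i} \<subseteq> {a n i<..<b n i}" if "i \<in> X n" for i
      using gap_bounds[OF n1, of i] that unfolding X_def by auto
    have disj': "disjoint_family_on (\<lambda>i. {c n i<..<d n i}) (X n)"
      by (rule disjoint_family_on_bisimulation[OF disj]) (use sub in blast)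
    have "emeasure M (G n) = (\<integral>\<^sup>+i. emeasure M {c n i<..<d n i} \<partial>count_space (X n))"
      unfolding G_def by (rule emeasure_UN_countable[OF _ count disj']) (simp add: sets)
    also have "\<dots> \<le> (\<integral>\<^sup>+i. ennreal (\<beta> n) * emeasure M {a n i<..<b n i} \<partial>count_space (X n))"
      using bound[OF n] by (intro nn_integral_mono) (auto simp: X_def)
    also have "\<dots> = ennreal (\<beta> n) * emeasure M (\<Union>i\<in>X n. {a n i<..<b n i})"
      by (subst emeasure_UN_countable[OF _ count disj]) (simp_all add: sets nn_integral_cmult)
    also have "\<dots> \<le> ennreal (\<beta> n) * emeasure M ?E"
    proof (intro mult_left_mono emeasure_mono)
      show "(\<Union>i\<in>X n. {a n i<..<b n i}) \<subseteq> ?E"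
        unfolding X_def using greaterThanLessThan_subseteq_atLeastAtMost_iff by fastforce
    qed (auto simp: sets)
    finally show ?thesis .
  qed
  have "?E - (\<Union>n. G (n + N)) \<subseteq> cantor_set Ix a b"
  proof
    fix x assume x: "x \<in> ?E - (\<Union>n. G (n + N))"
    show "x \<in> cantor_set Ix a b"
    proof (rule not_gap_imp_cantor_set[OF N])
      fix n i assume "N \<le> n" "i \<in> Ix n" "{a n i..b n i} \<subseteq> ?E"
      moreover have "x \<notin> G (n - N + N)" using x by blast
      ultimately show "x \<notin> {c n i<..<d n i}" by (auto simp: G_def X_def)
    qed (use x in simp)
  qed
  then have "?E \<subseteq> cantor_set Ix a b \<union> (\<Union>n. G (n + N))" by blast
  then have "emeasure M ?E \<le> emeasure M (cantor_set Ix a b \<union> (\<Union>n. G (n + N)))"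
    using cantor_set_borel union_sets by (intro emeasure_mono sets.Un) (auto simp: sets)
  also have "\<dots> \<le> emeasure M (cantor_set Ix a b) + emeasure M (\<Union>n. G (n + N))"
    using cantor_set_borel union_sets by (intro emeasure_subadditive) (auto simp: sets)
  also have "\<dots> \<le> (\<Sum>n. emeasure M (G (n + N)))"
    using G_sets unfolding null by (simp, intro emeasure_subadditive_countably) (auto simp: sets)
  also have "\<dots> \<le> (\<Sum>n. ennreal (\<beta> (n + N)) * emeasure M ?E)"
    by (intro suminf_le G summableI) auto
  also have "\<dots> = (\<Sum>n. ennreal (\<beta> (n + N))) * emeasure M ?E"
    by (rule ennreal_suminf_multc)
  also have "(\<Sum>n. ennreal (\<beta> (n + N))) = ennreal (\<Sum>n. \<beta> (n + N))"
    using \<beta> by (intro suminf_ennreal2) auto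
  also have "ennreal (\<Sum>n. \<beta> (n + N)) * emeasure M ?E < 1 * emeasure M ?E"
    using mass \<beta>(3) by (intro ennreal_mult_strict_right_mono) (auto simp: ennreal_less_one_iff)
  finally show False by simp
qed

end

section \<open>Positive mass of the Cantor set\<close>

lemma doubling_measure_Icc:
  assumes "doubling_measure M" "x < y"
  shows "0 < emeasure M {x..y}" "emeasure M {x..y} < \<infinity>"
proof -
  have sets: "sets M = sets borel"
    and ball: "r > 0 \<Longrightarrow> 0 < emeasure M (ball u (2 * r)) \<and> emeasure M (ball u r) < \<infinity>" for u r
    using assms(1) unfolding doubling_measure_def by blast+
  define u where "u = (x + y) / 2"
  \<comment> \<open>With a quarter of the length, \<open>ball u (2 * r)\<close> is the interior of
    the interval, and positivity is available for doubled radii.\<close>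
  define r where "r = (y - x) / 4"
  have "0 < r" using assms(2) by (simp add: r_def)
  have xy: "x = u - 2 * r" "y = u + 2 * r"
    by (simp_all add: u_def r_def field_simps)
  have "emeasure M (ball u (2 * r)) \<le> emeasure M {x..y}"
    by (intro emeasure_mono) (auto simp: xy dist_real_def sets)
  then show "0 < emeasure M {x..y}"
    using ball[OF \<open>0 < r\<close>, of u] by (auto intro: less_le_trans)
  have "emeasure M {x..y} \<le> emeasure M (ball u (3 * r))"
    using \<open>0 < r\<close> by (intro emeasure_mono) (auto simp: xy dist_real_def sets)
  also have "\<dots> < \<infinity>" using ball[of "3 * r" u] \<open>0 < r\<close> by simp
  finally show "emeasure M {x..y} < \<infinity>" .
qed

theorem theorem2p2:
  fixes Ix :: "nat \<Rightarrow> 'i set" and a b c d :: "nat \<Rightarrow> 'i \<Rightarrow> real"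
    and \<alpha> :: "nat \<Rightarrow> real" and p :: real
  assumes "cantor_construction Ix a b c d"
    and "Ix 1 \<noteq> {}"
    and "nice_construction Ix a b c d"
    and "thick_construction \<alpha> Ix a b c d"
    and "\<forall>n\<ge>1. 0 < \<alpha> n \<and> \<alpha> n < 1"
    and "0 < p"
    and "summable (\<lambda>n. \<alpha> n powr p)"
  shows "\<exists>M. doubling_measure M \<and> emeasure M (cantor_set Ix a b) > 0"
proof -
  obtain t where t: "t < 1" and meet: "\<And>n i. 1 \<le> n \<Longrightarrow> i \<in> Ix n \<Longrightarrow>
      \<exists>x. x \<in> conc_interval t (a n i) (b n i) \<inter> {c n i<..<d n i}"
    using assms(3) unfolding nice_construction_def by blast
  \<comment> \<open>The concentric interval of relative length \<open>t\<close> leaves a margin of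
    \<open>(1 - t) / 2\<close> times the length on either side.\<close>
  define \<eta> where "\<eta> = (1 - t) / 2"
  define z where "z n i = (SOME x. x \<in> conc_interval t (a n i) (b n i) \<inter> {c n i<..<d n i})" for n i
  interpret centred_cantor Ix a b c d z \<eta>
  proof
    show "0 < \<eta>" using t by (simp add: \<eta>_def)
    fix n i assume "1 \<le> n" "i \<in> Ix n"
    then have "z n i \<in> conc_interval t (a n i) (b n i) \<inter> {c n i<..<d n i}"
      unfolding z_def by (rule someI_ex[OF meet])
    moreover have "(a n i + b n i) / 2 - t * (b n i - a n i) / 2 = a n i + \<eta> * (b n i - a n i)"
      "(a n i + b n i) / 2 + t * (b n i - a n i) / 2 = b n i - \<eta> * (b n i - a n i)"
      unfolding \<eta>_def by (simp_all add: field_simps)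
    ultimately show "c n i < z n i \<and> z n i < d n i \<and>
        a n i + \<eta> * (b n i - a n i) \<le> z n i \<and> z n i \<le> b n i - \<eta> * (b n i - a n i)"
      unfolding conc_interval_def by simp
  qed (rule assms(1))
  \<comment> \<open>A natural exponent with \<open>q \<ge> p\<close> and \<open>q \<ge> 1\<close>;
    as \<open>\<alpha> n < 1\<close>, passing from \<open>q\<close> to \<open>p\<close> only
    increases the power.\<close>
  define q where "q = max 1 (nat \<lceil>p\<rceil>)"
  \<comment> \<open>Half the margin: \<open>centres_separated\<close> becomes separation by
    \<open>2 * min L L'\<close>, and \<open>{z - L..z + L}\<close> stays inside the open
    interval.\<close>
  define L where "L n i = \<eta> / 2 * (b n i - a n i)" for n i
  define S where "S = {(z n i, L n i, d n i - c n i) |n i. 1 \<le> n \<and> i \<in> Ix n}"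
  interpret G: gap_system S q
  proof
    show "1 \<le> q" by (simp add: q_def)
    fix x L1 l x' L2 l'
    assume "(x, L1, l) \<in> S" "(x', L2, l') \<in> S"
    then obtain n i m j where nm: "1 \<le> n" "i \<in> Ix n" "1 \<le> m" "j \<in> Ix m"
      and eq: "x = z n i" "L1 = L n i" "l = d n i - c n i" "x' = z m j" "L2 = L m j" "l' = d m j - c m j"
      unfolding S_def by auto
    have "2 * min L1 L2 = \<eta> * min (b n i - a n i) (b m j - a m j)"
      using margin_pos by (simp add: eq L_def min_mult_distrib_left)
    then show "(x, L1, l) = (x', L2, l') \<or> 2 * min L1 L2 \<le> \<bar>x - x'\<bar>"
      using centres_separated[OF nm] unfolding eq by auto
  qed
  define M where "M = G.cascade_measure"
  \<comment> \<open>The factor of \<open>gap_mass\<close> with \<open>16 * l / L\<close> rewritten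
    as \<open>32 / \<eta>\<close> times the relative length of the gap.\<close>
  define K where "K = 4 * G.ratio ^ 2 * (32 / \<eta>) ^ q"
  have "0 < K"
    using G.ratio_ge_1 margin_pos unfolding K_def by (intro mult_pos_pos zero_less_power) auto
  have bound: "emeasure M {c n i<..<d n i} \<le> ennreal (K * \<alpha> n powr p) * emeasure M {a n i<..<b n i}"
    if n: "1 \<le> n" and i: "i \<in> Ix n" and small: "b n i - a n i \<le> 1" for n i
  proof -
    have g: "a n i \<le> c n i" "d n i \<le> b n i" "c n i < d n i" "a n i < b n i"
      using gap_bounds[OF n i] .
    have z: "c n i < z n i" "z n i < d n i" "a n i + 2 * L n i \<le> z n i" "z n i \<le> b n i - 2 * L n i"
      using centred[OF n i] by (auto simp: L_def)
    have L: "0 < L n i" using margin_pos g by (simp add: L_def)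
    have \<alpha>: "0 < \<alpha> n" "\<alpha> n < 1" using assms(5) n by auto
    have "(16 * (d n i - c n i) / L n i) ^ q \<le> (32 / \<eta>) ^ q * \<alpha> n powr p"
    proof -
      have "d n i - c n i \<le> \<alpha> n * (b n i - a n i)"
        using assms(4) n i unfolding thick_construction_def by blast
      then have "(d n i - c n i) / (b n i - a n i) \<le> \<alpha> n"
        using g by (simp add: pos_divide_le_eq)
      then have "32 / \<eta> * ((d n i - c n i) / (b n i - a n i)) \<le> 32 / \<eta> * \<alpha> n"
        using margin_pos by (intro mult_left_mono) auto
      then have "16 * (d n i - c n i) / L n i \<le> 32 / \<eta> * \<alpha> n"
        by (simp add: L_def)
      then have "(16 * (d n i - c n i) / L n i) ^ q \<le> (32 / \<eta> * \<alpha> n) ^ q"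
        using g L by (intro power_mono) auto
      also have "\<dots> = (32 / \<eta>) ^ q * \<alpha> n powr real q"
        using \<alpha> unfolding power_mult_distrib by (simp add: powr_realpow)
      also have "\<dots> \<le> (32 / \<eta>) ^ q * \<alpha> n powr p"
      proof (intro mult_left_mono powr_mono')
        show "p \<le> real q" unfolding q_def by linarith
      qed (use \<alpha> margin_pos in auto)
      finally show ?thesis .
    qed
    then have "4 * G.ratio ^ 2 * (16 * (d n i - c n i) / L n i) ^ q \<le> K * \<alpha> n powr p"
      unfolding K_def mult.assoc[of _ "(32 / \<eta>) ^ q"] by (intro mult_left_mono) auto
    then have "ennreal (4 * G.ratio ^ 2 * (16 * (d n i - c n i) / L n i) ^ q) * emeasure M {a n i<..<b n i}
        \<le> ennreal (K * \<alpha> n powr p) * emeasure M {a n i<..<b n i}"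
      by (intro mult_right_mono ennreal_leI) auto
    moreover have "emeasure M {c n i<..<d n i} \<le>
        ennreal (4 * G.ratio ^ 2 * (16 * (d n i - c n i) / L n i) ^ q) * emeasure M {a n i<..<b n i}"
      unfolding M_def
    proof (rule G.gap_mass)
      show "(z n i, L n i, d n i - c n i) \<in> S" using n i unfolding S_def by blast
      show "L n i \<le> 1" using z L g small by linarith
    qed (use g z L small in auto)
    ultimately show ?thesis by (rule order_trans[rotated])
  qed
  \<comment> \<open>\<open>gap_mass\<close> needs lengths at most 1, since the coarsest cells are
    unit intervals.\<close>
  obtain N1 where N1: "\<And>n i. N1 \<le> n \<Longrightarrow> i \<in> Ix n \<Longrightarrow> b n i - a n i \<le> 1"
    using assms(1)[unfolded cantor_construction_def, THEN conjunct2, THEN conjunct2, THEN conjunct2,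
        THEN conjunct2, THEN conjunct1, rule_format, of 1] by auto
  have summable: "summable (\<lambda>n. K * \<alpha> n powr p)"
    using assms(7) by (rule summable_mult)
  obtain N2 where N2: "\<And>n. N2 \<le> n \<Longrightarrow> norm (\<Sum>i. K * \<alpha> (i + n) powr p) < 1"
    using suminf_exist_split[OF zero_less_one summable] by blast
  define N where "N = max 1 (max N1 N2)"
  have N: "1 \<le> N" "N1 \<le> N" "N2 \<le> N" by (auto simp: N_def)
  obtain i0 where i0: "i0 \<in> Ix N"
    using index_nonempty[OF assms(2) N(1)] by blast
  have doubling: "doubling_measure M"
    unfolding M_def by (rule G.doubling_cascade_measure)
  have "0 < emeasure M (cantor_set Ix a b)"
  proof (rule cantor_set_positive[OF _ N(1) i0])
    show "sets M = sets borel" by (simp add: M_def)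
    show "0 < emeasure M {a N i0..b N i0}" "emeasure M {a N i0..b N i0} < \<infinity>"
      using doubling_measure_Icc[OF doubling gap_bounds(4)[OF N(1) i0]] by auto
    show "emeasure M {c n i<..<d n i} \<le> ennreal (K * \<alpha> n powr p) * emeasure M {a n i<..<b n i}"
      if "N \<le> n" "i \<in> Ix n" for n i
      using bound[of n i] N1[of n i] N that by auto
    show "summable (\<lambda>n. K * \<alpha> (n + N) powr p)"
      using summable by (rule summable_ignore_initial_segment)
    show "(\<Sum>n. K * \<alpha> (n + N) powr p) < 1"
      using N2[OF N(3)] by simp
  qed (use \<open>0 < K\<close> in simp)
  then show ?thesis using doubling by blast
qed

end
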